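(* Let $t\ge2$ be an integer and set $\mathbf{e}=(1,2,\ldots,t)$. There is a bijection $\varphi: SC_{(t+1)} \times DD_{(t+1)}\to \mathbb{Z}^t$ such that for every pair $(\lambda,\mu)$, writing $\varphi(\lambda,\mu)=\mathbf{n}=(n_1,\ldots,n_t)$, one has \[ |\lambda|+|\mu|=(t+1) \|\mathbf{n}\|^2 +\mathbf{e} \cdot \mathbf{n} = \sum_{i=1}^t\big((t+1)n_i^2+i\,n_i\big), \] and, for every $i\in\{1,\ldots,t\}$, \[ t+1+\Delta_i= \sigma_i \big((2t+2)n_i+i\big), \] where $\sigma_i=1$ if $n_i\ge0$ and $\sigma_i=-1$ if $n_i<0$.
   Context: A partition $\lambda=(\lambda_1\ge\dots\ge\lambda_\ell>0)$ has weight $|\lambda|=\sum_i\lambda_i$, conjugate $\lambda'$, hook lengths $h(i,j)=\lambda_i-j+\lambda'_j-i+1$ for boxes $(i,j)$, $1\le j\le \lambda_i$; the principal hook lengths are $h(i,i)$ for the indices $i$ with $\lambda_i\ge i$. For a positive integer $s$, an $s$-core is a partition none of whose hook lengths is divisible by $s$. Self-conjugate means $\lambda=\lambda'$. A doubled distinct partition is either empty or, for integers $a_1>\dots>a_d\ge1$, the partition with exactly $d$ indices $i$ with $\lambda_i\ge i$ and with $\lambda_i-i=a_i$, $\lambda'_i-i=a_i-1$ for $1\le i\le d$. $SC_{(s)}$ (resp. $DD_{(s)}$) is the set of self-conjugate (resp. doubled distinct) $s$-cores. $\|\cdot\|$ is the Euclidean norm and $\cdot$ the standard scalar product. For $(\lambda,\mu)\in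 SC_{(t+1)}\times DD_{(t+1)}$, $\Delta$ denotes the set consisting of the principal hook lengths of $\lambda$ together with those of $\mu$, and for $i\in\{1,\dots,t\}$, $\Delta_i:=\max\big(\{h\in\Delta : h\equiv i-t-1 \text{ or } h\equiv -i-t-1 \pmod{2t+2}\}\cup\{i-t-1\}\big)$. *)

theory Defs
  imports "HOL-Analysis.L2_Norm" "HOL-Number_Theory.Cong" "HOL-Library.FuncSet"
begin

definition partitions :: "nat list set" where
  "partitions = {l. sorted_wrt (\<ge>) l \<and> (\<forall>x\<in>set l. 0 < x)}"

definition weight :: "nat list \<Rightarrow> nat" where
  "weight l = sum_list l"

(* The parts are numbered from 1, whereas list positions start at 0; part l i is 0 beyond
   the last part. *)
definition part :: "nat list \<Rightarrow> nat \<Rightarrow> nat" where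
  "part l i = (if 1 \<le> i \<and> i \<le> length l then l ! (i - 1) else 0)"

definition conjugate :: "nat list \<Rightarrow> nat list" where
  "conjugate l = map (\<lambda>j. card {i \<in> {1..length l}. j \<le> part l i}) [1..<part l 1 + 1]"

definition boxes :: "nat list \<Rightarrow> (nat \<times> nat) set" where
  "boxes l = {(i, j). 1 \<le> i \<and> i \<le> length l \<and> 1 \<le> j \<and> j \<le> part l i}"

definition hook_length :: "nat list \<Rightarrow> nat \<Rightarrow> nat \<Rightarrow> int" where
  "hook_length l i j =
     int (part l i) - int j + int (part (conjugate l) j) - int i + 1"

definition diagonal :: "nat list \<Rightarrow> nat set" where
  "diagonal l = {i. 1 \<le> i \<and> i \<le> part l i}"

definition principal_hook_lengths :: "nat list \<Rightarrow> int set" where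
  "principal_hook_lengths l = (\<lambda>i. hook_length l i i) ` diagonal l"

definition is_core :: "nat \<Rightarrow> nat list \<Rightarrow> bool" where
  "is_core s l \<longleftrightarrow> (\<forall>(i, j) \<in> boxes l. \<not> int s dvd hook_length l i j)"

definition self_conjugate :: "nat list \<Rightarrow> bool" where
  "self_conjugate l \<longleftrightarrow> conjugate l = l"

definition doubled_distinct :: "nat list \<Rightarrow> bool" where
  "doubled_distinct l \<longleftrightarrow> l = [] \<or>
     (\<exists>(d :: nat) (a :: nat \<Rightarrow> int). 1 \<le> d \<and>
        (\<forall>i j. 1 \<le> i \<and> i < j \<and> j \<le> d \<longrightarrow> a i > a j) \<and> a d \<ge> 1 \<and>
        card (diagonal l) = d \<and>
        (\<forall>i \<in> {1..d}. int (part l i) - int i = a i \<and>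
                        int (part (conjugate l) i) - int i = a i - 1))"

definition SC :: "nat \<Rightarrow> nat list set" where
  "SC s = {l \<in> partitions. self_conjugate l \<and> is_core s l}"

definition DD :: "nat \<Rightarrow> nat list set" where
  "DD s = {l \<in> partitions. doubled_distinct l \<and> is_core s l}"

definition Delta :: "nat list \<times> nat list \<Rightarrow> int set" where
  "Delta p = principal_hook_lengths (fst p) \<union> principal_hook_lengths (snd p)"

definition Delta_max :: "nat \<Rightarrow> nat list \<times> nat list \<Rightarrow> nat \<Rightarrow> int" where
  "Delta_max t p i =
     Max ({h \<in> Delta p. [h = int i - int t - 1] (mod (2 * int t + 2)) \<or>
                        [h = - int i - int t - 1] (mod (2 * int t + 2))}
          \<union> {int i - int t - 1})"

(* Z^t, with coordinates numbered from 1 to t; outside that range a vector takes the value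
   undefined, so that it is determined by its coordinates. *)
definition int_vectors :: "nat \<Rightarrow> (nat \<Rightarrow> int) set" where
  "int_vectors t = {1..t} \<rightarrow>\<^sub>E UNIV"

definition euclidean_norm :: "nat \<Rightarrow> (nat \<Rightarrow> int) \<Rightarrow> real" where
  "euclidean_norm t n = L2_set (\<lambda>i. real_of_int (n i)) {1..t}"

definition scalar_product :: "nat \<Rightarrow> (nat \<Rightarrow> int) \<Rightarrow> (nat \<Rightarrow> int) \<Rightarrow> int" where
  "scalar_product t x y = (\<Sum>i = 1..t. x i * y i)"

definition e_vec :: "nat \<Rightarrow> nat \<Rightarrow> int" where
  "e_vec t = (\<lambda>i \<in> {1..t}. int i)"

definition sign_of :: "int \<Rightarrow> int" where
  "sign_of m = (if m \<ge> 0 then 1 else - 1)"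

end

(* Encode a partition by its beads, the integers part l i - i (its Maya diagram). Conjugation
   becomes x -> -1 - x followed by complementation, and the hook lengths of row i are the
   differences x - y of the bead x = part l i - i and the gaps y < x; so l is an s-core iff its
   beads are closed under subtracting s. For a self-conjugate (doubled distinct) partition the
   principal hook lengths are the numbers 2 x + 1 (resp. 2 x) for the nonnegative beads x, and
   they sum to the weight. Hence a pair in SC x DD is the same as one set S of integers, the odd
   elements coming from the first partition and the even ones from the second, with x in S iff
   -x not in S for x other than 0, 0 not in S, and S - 2 s contained in S; its nonnegative
   elements form Delta. In each residue class i - s modulo 2 s, 0 < i < s, such an S is a ray
   k <= n_i, and the symmetry and these numbers n_i determine the rest of S. *)

theory Submission
  imports Defs
begin

section \<open>Beads of a partition\<close>

definition beads :: "nat list \<Rightarrow> int set" where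
  "beads l = (\<lambda>i. int (part l i) - int i) ` {1..}"

lemma part_antimono:
  assumes "l \<in> partitions" "1 \<le> i" "i \<le> j"
  shows "part l j \<le> part l i"
proof (cases "j \<le> length l \<and> i \<noteq> j")
  case True
  then have "l ! (j - 1) \<le> l ! (i - 1)"
    using assms by (auto simp: partitions_def intro!: sorted_wrt_nth_less[of "(\<ge>)"])
  then show ?thesis using True assms by (simp add: part_def)
qed (use assms in \<open>auto simp: part_def\<close>)

lemma part_pos_iff:
  assumes "l \<in> partitions"
  shows "0 < part l i \<longleftrightarrow> 1 \<le> i \<and> i \<le> length l"
  using assms by (auto simp: partitions_def part_def)

lemma part_eq_0: "length l < i \<Longrightarrow> part l i = 0"
  by (simp add: part_def)

lemma partition_eqI:
  assumes "l \<in> partitions" "m \<in> partitions" "\<And>i. 1 \<le> i \<Longrightarrow> part l i = part m i"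
  shows "l = m"
proof -
  have le: "length a \<le> length b"
    if "a \<in> partitions" "b \<in> partitions" "\<And>i. 1 \<le> i \<Longrightarrow> part a i = part b i" for a b
    using part_pos_iff[OF that(1), of "length a"] part_pos_iff[OF that(2), of "length a"]
      that(3)[of "length a"] by (cases "length a = 0") auto
  have len: "length l = length m"
    using le[of l m] le[of m l] assms by fastforce
  show ?thesis
  proof (rule nth_equalityI[OF len])
    fix i assume "i < length l"
    then show "l ! i = m ! i"
      using assms(3)[of "Suc i"] len by (simp add: part_def)
  qed
qed

lemma bead_strict_antimono:
  assumes "l \<in> partitions" "1 \<le> i" "i < j"
  shows "int (part l j) - int j < int (part l i) - int i"
  using part_antimono[of l i j] assms by linarith

lemma bead_le_iff:
  assumes "l \<in> partitions" "1 \<le> i" "1 \<le> j"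
  shows "int (part l i) - int i \<le> int (part l j) - int j \<longleftrightarrow> j \<le> i"
  using bead_strict_antimono[of l i j] bead_strict_antimono[of l j i] assms
  by (cases i j rule: linorder_cases) auto

lemma inj_on_bead:
  assumes "l \<in> partitions"
  shows "inj_on (\<lambda>i. int (part l i) - int i) {1..}"
  by (rule inj_onI) (metis assms atLeast_iff bead_le_iff dual_order.antisym order_refl)

text \<open>Beads strictly decrease from row to row, so the row of a bead is its rank from the top.
  The row number is thus recovered from the bead set alone; this gives injectivity of
  \<open>beads\<close> and later compares rows of a partition with rows of its conjugate.\<close>

lemma card_beads_ge:
  assumes "l \<in> partitions" "1 \<le> i"
  shows "card {z \<in> beads l. int (part l i) - int i \<le> z} = i"
proof -
  have "{z \<in> beads l. int (part l i) - int i \<le> z} = (\<lambda>i. int (part l i) - int i) ` {1..i}"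
    using assms by (auto simp: beads_def bead_le_iff)
  moreover have "inj_on (\<lambda>i. int (part l i) - int i) {1..i}"
    by (rule inj_on_subset[OF inj_on_bead[OF assms(1)]]) auto
  ultimately show ?thesis by (simp add: card_image)
qed

lemma bead_of_rank:
  assumes "l \<in> partitions" "x \<in> beads l" "card {z \<in> beads l. x \<le> z} = i"
  shows "int (part l i) - int i = x"
  using assms card_beads_ge[OF assms(1)] by (auto simp: beads_def)

lemma beads_inj:
  assumes "l \<in> partitions" "m \<in> partitions" "beads l = beads m"
  shows "l = m"
proof (rule partition_eqI[OF assms(1,2)])
  fix i :: nat assume "1 \<le> i"
  moreover from this have "int (part l i) - int i \<in> beads m"
    unfolding assms(3)[symmetric] by (auto simp: beads_def)
  ultimately have "int (part m i) - int i = int (part l i) - int i"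
    using card_beads_ge[of l i] assms by (intro bead_of_rank) auto
  then show "part l i = part m i" by simp
qed

section \<open>Conjugation, hook lengths and cores\<close>

lemma length_conjugate: "length (conjugate l) = part l 1"
  by (simp add: conjugate_def)

text \<open>As parts weakly decrease, the rows reaching column j form an initial segment
  \<open>?C\<close>, whose size is at least i exactly when row i lies in it. Columns beyond the
  first part have length 0.\<close>

lemma le_part_conjugate_iff:
  assumes "l \<in> partitions" "1 \<le> i" "1 \<le> j"
  shows "i \<le> part (conjugate l) j \<longleftrightarrow> j \<le> part l i"
proof (cases "j \<le> part l 1")
  case True
  let ?C = "{k \<in> {1..length l}. j \<le> part l k}"
  have "[1..<part l 1 + 1] ! (j - 1) = j"
    using True assms(3) by (subst nth_upt) auto
  then have "conjugate l ! (j - 1) = card ?C"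
    unfolding conjugate_def using True assms(3) by (subst nth_map) auto
  then have eq: "part (conjugate l) j = card ?C"
    using True assms(3) by (simp add: part_def[of "conjugate l"] length_conjugate)
  have fin: "finite ?C" by simp
  have inC: "k \<in> ?C \<longleftrightarrow> 1 \<le> k \<and> j \<le> part l k" for k
    using part_eq_0[of l k] assms(3) by (cases "k \<le> length l") auto
  show ?thesis
  proof
    assume "i \<le> part (conjugate l) j"
    show "j \<le> part l i"
    proof (rule ccontr)
      assume neg: "\<not> j \<le> part l i"
      have "?C \<subseteq> {1..<i}"
      proof
        fix k assume "k \<in> ?C"
        then show "k \<in> {1..<i}"
          using neg part_antimono[OF assms(1,2), of k] by (cases "i \<le> k") auto
      qed
      from card_mono[OF _ this] have "card ?C \<le> i - 1" by simp
      then show False using \<open>i \<le> part (conjugate l) j\<close> eq assms by linarith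
    qed
  next
    assume "j \<le> part l i"
    have "{1..i} \<subseteq> ?C"
    proof
      fix k assume "k \<in> {1..i}"
      then show "k \<in> ?C"
        unfolding inC using \<open>j \<le> part l i\<close> part_antimono[OF assms(1), of k i] by auto
    qed
    from card_mono[OF fin this] show "i \<le> part (conjugate l) j" by (simp add: eq)
  qed
next
  case False
  then have "part (conjugate l) j = 0"
    by (simp add: part_eq_0 length_conjugate)
  moreover have "part l i \<le> part l 1" using part_antimono[OF assms(1), of 1 i] assms by simp
  ultimately show ?thesis using False assms by auto
qed

lemma conjugate_in_partitions:
  assumes "l \<in> partitions"
  shows "conjugate l \<in> partitions"
proof -
  note len = length_conjugate[of l]
  have nth: "conjugate l ! k = part (conjugate l) (Suc k)" if "k < part l 1" for k
    using that len by (simp add: part_def)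
  have "conjugate l ! j \<le> conjugate l ! i" if "i < j" "j < part l 1" for i j
  proof (cases "part (conjugate l) (Suc j) = 0")
    case False
    let ?k = "part (conjugate l) (Suc j)"
    have "Suc j \<le> part l ?k"
      using le_part_conjugate_iff[OF assms, of ?k "Suc j"] False by simp
    then have "?k \<le> part (conjugate l) (Suc i)"
      using le_part_conjugate_iff[OF assms, of ?k "Suc i"] False that by simp
    then show ?thesis using nth that by simp
  qed (use nth that in auto)
  moreover have "0 < conjugate l ! k" if "k < part l 1" for k
    using le_part_conjugate_iff[OF assms, of 1 "Suc k"] that nth by simp
  ultimately show ?thesis
    by (auto simp: partitions_def sorted_wrt_iff_nth_less len in_set_conv_nth)
qed

text \<open>For row i and column j, the bead of the row plus the bead of the column plus 1 is at
  least 1 if the box (i, j) lies in the diagram and at most -1 otherwise. It never vanishes, so no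
  bead of the conjugate reflects to a bead of \<open>l\<close>; conversely, every gap is the
  reflection of a column.\<close>

lemma beads_conjugate:
  assumes "l \<in> partitions"
  shows "beads (conjugate l) = {x. - 1 - x \<notin> beads l}"
proof (intro equalityI subsetI)
  fix x assume "x \<in> beads (conjugate l)"
  then obtain j where j: "1 \<le> j" "x = int (part (conjugate l) j) - int j"
    by (auto simp: beads_def)
  have "- 1 - x \<noteq> int (part l i) - int i" if "1 \<le> i" for i
    using le_part_conjugate_iff[OF assms that j(1)] j
    by (cases "i \<le> part (conjugate l) j") auto
  then show "x \<in> {x. - 1 - x \<notin> beads l}" by (auto simp: beads_def)
next
  fix x assume "x \<in> {x. - 1 - x \<notin> beads l}"
  then have notin: "int (part l i) - int i \<noteq> - 1 - x" if "1 \<le> i" for i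
  proof -
    have "int (part l i) - int i \<in> beads l"
      unfolding beads_def using that by (intro image_eqI[of _ _ i]) simp_all
    then show ?thesis using \<open>x \<in> {x. - 1 - x \<notin> beads l}\<close> by auto
  qed
  \<comment> \<open>\<open>P i\<close> says that the bead of row i + 1 lies below the gap -1 - x.
    The least such i, called \<open>c\<close>, counts the beads above the gap, and the column j = c
    - x has length exactly \<open>c\<close>.\<close>
  define P where "P = (\<lambda>i. int (part l (Suc i)) - int (Suc i) < - 1 - x)"
  have ex: "P (length l + nat \<bar>x\<bar> + 1)" by (simp add: P_def part_eq_0)
  define c where "c = (LEAST i. P i)"
  have c: "P c" unfolding c_def by (rule LeastI[of P, OF ex])
  have c': "\<not> P i" if "i < c" for i using that not_less_Least unfolding c_def by blast
  define j where "j = nat (int c - x)"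
  have jeq: "int j = int c - x" and j1: "1 \<le> j" using c by (auto simp: j_def P_def)
  have "\<not> j \<le> part l (Suc c)" using c jeq by (simp add: P_def)
  then have 1: "part (conjugate l) j \<le> c"
    using le_part_conjugate_iff[OF assms, of "Suc c" j] j1 by simp
  have 2: "c \<le> part (conjugate l) j"
  proof (cases c)
    case (Suc b)
    have "\<not> P b" using c' Suc by simp
    then have "j \<le> part l c" using notin[of c] jeq Suc by (simp add: P_def)
    then show ?thesis using le_part_conjugate_iff[OF assms, of c j] j1 Suc by simp
  qed simp
  have "x = int (part (conjugate l) j) - int j" using 1 2 jeq by simp
  then show "x \<in> beads (conjugate l)" using j1 by (auto simp: beads_def)
qed

text \<open>By \<open>beads_conjugate\<close> a gap is -1 minus a bead of the conjugate, so a bead x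
  with gap x - s yields a hook of length s. Conversely, closure under subtracting s iterates, and a
  hook of length s * k would make its gap a bead.\<close>

lemma is_core_iff_beads:
  assumes "l \<in> partitions" "1 \<le> s"
  shows "is_core s l \<longleftrightarrow> (\<forall>x\<in>beads l. x - int s \<in> beads l)"
proof
  assume core: "is_core s l"
  show "\<forall>x\<in>beads l. x - int s \<in> beads l"
  proof (intro ballI, rule ccontr)
    fix x assume x: "x \<in> beads l" "x - int s \<notin> beads l"
    then have "int s - x - 1 \<in> beads (conjugate l)"
      by (simp add: beads_conjugate[OF assms(1)])
    then obtain j where j: "1 \<le> j" "int s - x - 1 = int (part (conjugate l) j) - int j"
      by (auto simp: beads_def)
    obtain i where i: "1 \<le> i" "x = int (part l i) - int i"
      using x by (auto simp: beads_def)
    have h: "hook_length l i j = int s" using i j by (simp add: hook_length_def)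
    have "j \<le> part l i"
      using le_part_conjugate_iff[OF assms(1) i(1) j(1)] h assms(2)
      by (auto simp: hook_length_def)
    moreover from this have "i \<le> length l" using part_pos_iff[OF assms(1), of i] j by simp
    ultimately have "(i, j) \<in> boxes l" using i j by (simp add: boxes_def)
    then show False using core h by (auto simp: is_core_def)
  qed
next
  assume cl: "\<forall>x\<in>beads l. x - int s \<in> beads l"
  have cl': "x - int s * int k \<in> beads l" if "x \<in> beads l" for x k
    using that
  proof (induction k)
    case (Suc k)
    then have "x - int s * int k - int s \<in> beads l" using cl by blast
    then show ?case by (simp add: algebra_simps)
  qed simp
  show "is_core s l" unfolding is_core_def
  proof (clarify)
    fix i j assume ij: "(i, j) \<in> boxes l" and dvd: "int s dvd hook_length l i j"
    have 1: "1 \<le> i" "1 \<le> j" "j \<le> part l i" using ij by (auto simp: boxes_def)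
    then have 2: "i \<le> part (conjugate l) j" using le_part_conjugate_iff[OF assms(1)] by simp
    obtain k where k: "hook_length l i j = int s * k" using dvd by blast
    have "0 < hook_length l i j" using 1 2 by (simp add: hook_length_def)
    then have "0 < k" unfolding k using assms(2) by (simp add: zero_less_mult_iff)
    have "int (part l i) - int i - int s * int (nat k) \<in> beads l"
      by (rule cl') (use 1 in \<open>auto simp: beads_def\<close>)
    moreover have "int (part l i) - int i - int s * int (nat k)
        = - 1 - (int (part (conjugate l) j) - int j)"
      using k \<open>0 < k\<close> by (simp add: hook_length_def)
    ultimately have "- 1 - (int (part (conjugate l) j) - int j) \<in> beads l"
      by simp
    moreover have "int (part (conjugate l) j) - int j \<in> beads (conjugate l)"
      using 1 by (auto simp: beads_def)
    ultimately show False by (simp add: beads_conjugate[OF assms(1)])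
  qed
qed


section \<open>Mirror symmetry and weight\<close>

text \<open>With \<open>c = 1\<close> this is the symmetry of the beads of a self-conjugate partition, with
  \<open>c = 0\<close> that of a doubled distinct one (where it also forces \<open>0 \<notin> X\<close>).\<close>

definition mirrored :: "int \<Rightarrow> int set \<Rightarrow> bool" where
  "mirrored c X \<longleftrightarrow> (\<forall>x. x < 0 \<and> x \<notin> X \<longleftrightarrow> 0 \<le> - c - x \<and> - c - x \<in> X)"

lemma mirrored_gaps:
  assumes "mirrored c X"
  shows "{x. x < 0 \<and> x \<notin> X} = (\<lambda>x. - c - x) ` {x \<in> X. 0 \<le> x}"
proof -
  have "y \<in> (\<lambda>x. - c - x) ` {x \<in> X. 0 \<le> x} \<longleftrightarrow> 0 \<le> - c - y \<and> - c - y \<in> X" for y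
    by (auto intro!: image_eqI[of y _ "- c - y"])
  then show ?thesis using assms by (auto simp: mirrored_def)
qed

text \<open>At x = 0 the left side of the definition is false, which forces 0 out of X. For other x,
  the definition is applied at whichever of x and -x is negative.\<close>

lemma mirrored_0_iff: "mirrored 0 X \<longleftrightarrow> 0 \<notin> X \<and> (\<forall>x. x \<noteq> 0 \<longrightarrow> (- x \<in> X \<longleftrightarrow> x \<notin> X))"
proof
  assume *: "mirrored 0 X"
  show "0 \<notin> X \<and> (\<forall>x. x \<noteq> 0 \<longrightarrow> (- x \<in> X \<longleftrightarrow> x \<notin> X))"
  proof (intro conjI allI impI)
    show "0 \<notin> X" using *[unfolded mirrored_def, rule_format, of 0] by simp
    show "- x \<in> X \<longleftrightarrow> x \<notin> X" if "x \<noteq> 0" for x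
      using *[unfolded mirrored_def, rule_format, of x]
        *[unfolded mirrored_def, rule_format, of "- x"] that by (cases "x < 0") auto
  qed
next
  assume *: "0 \<notin> X \<and> (\<forall>x. x \<noteq> 0 \<longrightarrow> (- x \<in> X \<longleftrightarrow> x \<notin> X))"
  show "mirrored 0 X" unfolding mirrored_def
  proof
    fix x :: int
    show "x < 0 \<and> x \<notin> X \<longleftrightarrow> 0 \<le> - 0 - x \<and> - 0 - x \<in> X"
      using * by (cases "x = 0") auto
  qed
qed

lemma mirrored_0D: "mirrored 0 X \<Longrightarrow> x \<noteq> 0 \<Longrightarrow> - x \<in> X \<longleftrightarrow> x \<notin> X"
  unfolding mirrored_0_iff by blast

text \<open>The map x to -1 - x swaps negative and nonnegative integers, so unlike for c = 0 there
  is no exceptional point.\<close>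

lemma mirrored_1_iff: "mirrored 1 X \<longleftrightarrow> (\<forall>x. - 1 - x \<in> X \<longleftrightarrow> x \<notin> X)"
proof
  assume *: "mirrored 1 X"
  show "\<forall>x. - 1 - x \<in> X \<longleftrightarrow> x \<notin> X"
  proof
    show "- 1 - x \<in> X \<longleftrightarrow> x \<notin> X" for x
      using *[unfolded mirrored_def, rule_format, of x]
        *[unfolded mirrored_def, rule_format, of "- 1 - x"] by (cases "x < 0") auto
  qed
next
  assume *: "\<forall>x. - 1 - x \<in> X \<longleftrightarrow> x \<notin> X"
  show "mirrored 1 X" unfolding mirrored_def
  proof
    fix x :: int
    show "x < 0 \<and> x \<notin> X \<longleftrightarrow> 0 \<le> - 1 - x \<and> - 1 - x \<in> X"
      using *[rule_format, of x] by linarith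
  qed
qed

lemma beads_less: "l \<in> partitions \<Longrightarrow> x \<in> beads l \<Longrightarrow> x < int (part l 1)"
  using part_antimono[of l 1] by (fastforce simp: beads_def)

lemma mem_beads_of_small: "x < - int (length l) \<Longrightarrow> x \<in> beads l"
  unfolding beads_def by (rule image_eqI[of _ _ "nat (- x)"]) (auto simp: part_eq_0)

lemma finite_nonneg_beads: "l \<in> partitions \<Longrightarrow> finite {x \<in> beads l. 0 \<le> x}"
  by (rule finite_subset[of _ "{0..<int (part l 1)}"]) (auto dest: beads_less)

lemma self_conjugate_iff_mirrored:
  assumes "l \<in> partitions"
  shows "self_conjugate l \<longleftrightarrow> mirrored 1 (beads l)"
proof -
  have "self_conjugate l \<longleftrightarrow> beads (conjugate l) = beads l"
    using beads_inj[OF conjugate_in_partitions] assms by (auto simp: self_conjugate_def)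
  then show ?thesis by (auto simp: beads_conjugate[OF assms] mirrored_1_iff)
qed

text \<open>Compared with the empty partition, whose beads are the negative integers,
  \<open>l\<close> gains the beads \<open>P\<close> and loses the gaps \<open>G\<close>, so its
  weight is the sum of \<open>P\<close> minus the sum of \<open>G\<close>. The symmetry matches x in
  \<open>P\<close> with the gap -c - x, and the pair contributes 2 * x + c.\<close>

lemma weight_mirrored:
  assumes "l \<in> partitions" "mirrored c (beads l)"
  shows "int (weight l) = (\<Sum>x | x \<in> beads l \<and> 0 \<le> x. 2 * x + c)"
proof -
  define N where "N = length l"
  define f where "f = (\<lambda>i. int (part l i) - int i)"
  define P where "P = {x \<in> beads l. 0 \<le> x}"
  define G where "G = {x. x < 0 \<and> x \<notin> beads l}"
  have G: "G = (\<lambda>x. - c - x) ` P"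
    using mirrored_gaps[OF assms(2)] by (simp add: G_def P_def)
  have GN: "G \<subseteq> {- int N..<0}"
    using mem_beads_of_small[of _ l] by (force simp: G_def N_def)
  have finP: "finite P" unfolding P_def by (rule finite_nonneg_beads[OF assms(1)])
  \<comment> \<open>Rows after the last part have beads below -N, so the first N rows supply exactly
    the beads that are at least -N.\<close>
  have fi: "f ` {1..N} = P \<union> ({- int N..<0} - G)"
  proof -
    have "f i < - int N" if "N < i" for i using that by (simp add: f_def part_eq_0 N_def)
    moreover have "- int N \<le> f i" if "i \<le> N" for i using that by (simp add: f_def)
    ultimately have "f ` {1..N} = {x \<in> f ` {1..}. - int N \<le> x}"
      by (force simp: not_le[symmetric])
    then show ?thesis by (auto simp: P_def G_def beads_def f_def)
  qed
  have wt: "int (weight l) = (\<Sum>i = 1..N. int (part l i))"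
  proof -
    have "weight l = (\<Sum>k = 0..<N. l ! k)" by (simp add: weight_def sum_list_sum_nth N_def)
    also have "\<dots> = (\<Sum>k = 0..<N. part l (Suc k))" by (simp add: part_def N_def)
    also have "\<dots> = (\<Sum>i = 1..N. part l i)"
      by (simp only: sum.shift_bounds_Suc_ivl[symmetric] One_nat_def atLeastLessThanSuc_atLeastAtMost)
    finally show ?thesis by simp
  qed
  have neg: "(\<Sum>x = - int N..<0. x) = - (\<Sum>i = 1..N. int i)"
  proof -
    have "(\<Sum>i = 1..N. - int i) = (\<Sum>x = - int N..<0. x)"
      by (rule sum.reindex_bij_witness[of _ "\<lambda>x. nat (- x)" "\<lambda>i. - int i"]) auto
    then show ?thesis by (simp add: sum_negf)
  qed
  have sG: "\<Sum>G = (\<Sum>x\<in>P. - c - x)"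
    unfolding G by (subst sum.reindex) (auto simp: inj_on_def)
  have "(\<Sum>i = 1..N. f i) = \<Sum>(f ` {1..N})"
    using inj_on_subset[OF inj_on_bead[OF assms(1)], of "{1..N}"]
    by (subst sum.reindex) (auto simp: f_def)
  also have "\<dots> = \<Sum>P + \<Sum>({- int N..<0} - G)"
    unfolding fi by (rule sum.union_disjoint) (use finP in \<open>auto simp: P_def\<close>)
  also have "\<Sum>({- int N..<0} - G) = (\<Sum>x = - int N..<0. x) - \<Sum>G"
    by (rule sum_diff) (use GN in auto)
  finally have "(\<Sum>i = 1..N. f i) = \<Sum>P - (\<Sum>i = 1..N. int i) - (\<Sum>x\<in>P. - c - x)"
    by (simp add: neg sG)
  then have "int (weight l) = \<Sum>P - (\<Sum>x\<in>P. - c - x)"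
    by (simp add: wt f_def sum_subtractf)
  also have "\<dots> = (\<Sum>x\<in>P. 2 * x + c)"
    by (simp flip: sum_subtractf add: algebra_simps)
  finally show ?thesis by (simp add: P_def)
qed

section \<open>Partitions with prescribed beads\<close>

lemma beads_Nil: "beads [] = {..<0}"
  by (auto simp: beads_def part_eq_0 intro!: image_eqI[of _ _ "nat (- _)"])

lemma beads_Cons: "beads (k # l) = insert (int k - 1) ((\<lambda>x. x - 1) ` beads l)"
proof -
  have ge: "{1..} = insert 1 (Suc ` {1::nat..})"
  proof (intro equalityI subsetI)
    fix i :: nat assume "i \<in> {1..}"
    then show "i \<in> insert 1 (Suc ` {1..})"
      by (cases "i = 1") (auto intro!: image_eqI[of i Suc "i - 1"])
  qed auto
  have 1: "part (k # l) 1 = k" by (simp add: part_def)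
  have Suc: "(\<lambda>i. int (part (k # l) i) - int i) ` Suc ` {1..}
      = (\<lambda>x. x - 1) ` (\<lambda>i. int (part l i) - int i) ` {1..}"
    unfolding image_image by (rule image_cong) (auto simp: part_def)
  have "beads (k # l) = (\<lambda>i. int (part (k # l) i) - int i) ` insert 1 (Suc ` {1..})"
    unfolding beads_def by (rule arg_cong[OF ge])
  then show ?thesis by (simp only: image_insert 1 Suc beads_def of_nat_1)
qed

text \<open>Having N elements from -N upwards and everything below is the balance that holds for a
  partition with at most N parts. Unless X is the set of negative integers, the induction strips the
  largest element, which becomes the bead of the first row, and shifts the others up by 1 to undo
  \<open>beads_Cons\<close>.\<close>

lemma partition_with_beads:
  assumes "\<And>x. x < - int N \<Longrightarrow> x \<in> X"
    and "finite {x \<in> X. - int N \<le> x}" "card {x \<in> X. - int N \<le> x} = N"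
  shows "\<exists>l\<in>partitions. beads l = X"
  using assms
proof (induction N arbitrary: X)
  case 0
  from 0(2,3) have "{x \<in> X. - int 0 \<le> x} = {}" by simp
  then have "x \<in> X \<longleftrightarrow> x < 0" for x using 0(1)[of x] by (cases "x < 0") auto
  then have "X = beads []" by (auto simp: beads_Nil)
  then show ?case by (intro bexI[of _ "[]"]) (auto simp: partitions_def)
next
  case (Suc N)
  define Y where "Y = {x \<in> X. - int (Suc N) \<le> x}"
  define m where "m = Max Y"
  have Y: "finite Y" "card Y = Suc N" using Suc.prems by (auto simp: Y_def)
  then have ne: "Y \<noteq> {}" by auto
  have mY: "m \<in> Y" using Max_in[OF Y(1) ne] by (simp add: m_def)
  have Ym: "Y \<subseteq> {- int (Suc N)..m}" using Y(1) by (auto simp: m_def Y_def)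
  \<comment> \<open>The N + 1 elements of \<open>Y\<close> lie between -(N + 1) and
    \<open>m\<close>, so \<open>m\<close> is at least -1. Equality leaves only the empty partition;
    otherwise m + 1 is a positive first part.\<close>
  have "card Y \<le> nat (m + int (Suc N) + 1)" using card_mono[OF _ Ym] by simp
  then have "- 1 \<le> m" using Y by linarith
  then consider "m = - 1" | "0 \<le> m" by linarith
  then show ?case
  proof cases
    case 1
    have "Y = {- int (Suc N)..m}"
      by (rule card_subset_eq[OF _ Ym]) (use Y 1 in auto)
    then have mem: "x \<in> X \<and> - int (Suc N) \<le> x \<longleftrightarrow> - int (Suc N) \<le> x \<and> x \<le> - 1" for x
      using 1 by (auto simp: Y_def set_eq_iff)
    have "x \<in> X \<longleftrightarrow> x < 0" for x
      using mem[of x] Suc.prems(1)[of x] by (cases "x < - int (Suc N)") auto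
    then have "X = beads []" by (auto simp: beads_Nil)
    then show ?thesis by (intro bexI[of _ "[]"]) (auto simp: partitions_def)
  next
    case 2
    define X' where "X' = (\<lambda>x. x + 1) ` (X - {m})"
    have "\<exists>l\<in>partitions. beads l = X'"
    proof (rule Suc.IH)
      fix x assume "x < - int N"
      then show "x \<in> X'"
        using Suc.prems(1)[of "x - 1"] 2 by (auto simp: X'_def intro!: image_eqI[of x _ "x - 1"])
    next
      have eq: "{x \<in> X'. - int N \<le> x} = (\<lambda>x. x + 1) ` (Y - {m})"
        by (auto simp: X'_def Y_def)
      show "finite {x \<in> X'. - int N \<le> x}" unfolding eq using Y by simp
      show "card {x \<in> X'. - int N \<le> x} = N"
        unfolding eq using Y mY by (subst card_image) (auto simp: inj_on_def)
    qed
    then obtain l where l: "l \<in> partitions" "beads l = X'" by auto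
    have less: "x < m" if "x \<in> X - {m}" for x
    proof (cases "x \<in> Y")
      case True
      then show ?thesis using Ym that by auto
    next
      case False
      then show ?thesis using that 2 by (simp add: Y_def)
    qed
    have "int (part l 1) - 1 \<in> X'" unfolding l(2)[symmetric] beads_def
      by (rule image_eqI[of _ _ 1]) auto
    then obtain y where "y \<in> X - {m}" "int (part l 1) - 1 = y + 1"
      unfolding X'_def by blast
    then have le: "int (part l 1) \<le> m + 1" using less[of y] by simp
    have "x \<le> nat (m + 1)" if "x \<in> set l" for x
    proof -
      from that have "\<exists>i<length l. l ! i = x" by (simp add: in_set_conv_nth)
      then obtain i where "i < length l" "l ! i = x" by blast
      then have "part l (Suc i) = x" by (simp add: part_def)
      then show ?thesis using part_antimono[OF l(1), of 1 "Suc i"] le by simp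
    qed
    then have "nat (m + 1) # l \<in> partitions" using l(1) 2 by (auto simp: partitions_def)
    moreover have "beads (nat (m + 1) # l) = X"
    proof -
      have "beads (nat (m + 1) # l) = insert m (X - {m})"
        using 2 by (simp add: beads_Cons l(2) X'_def image_image)
      then show ?thesis using mY by (auto simp: Y_def)
    qed
    ultimately show ?thesis by blast
  qed
qed

text \<open>The symmetry pairs negative gaps with nonnegative elements, so there are equally many of
  both; this is the balance that \<open>partition_with_beads\<close> asks for.\<close>

lemma partition_with_mirrored_beads:
  assumes "mirrored c X" "0 \<le> c" "finite {x \<in> X. 0 \<le> x}"
  shows "\<exists>l\<in>partitions. beads l = X"
proof -
  define P where "P = {x \<in> X. 0 \<le> x}"
  define G where "G = {x. x < 0 \<and> x \<notin> X}"
  have G: "G = (\<lambda>x. - c - x) ` P"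
    using mirrored_gaps[OF assms(1)] by (simp add: G_def P_def)
  have fin: "finite P" "finite G" using assms(3) by (simp_all add: P_def[symmetric] G)
  have cG: "card G = card P" unfolding G by (rule card_image) (auto simp: inj_on_def)
  define N where "N = nat (- Min (insert 0 G))"
  have b: "Min (insert 0 G) \<le> x" if "x \<in> G" for x using fin that by simp
  have GN: "G \<subseteq> {- int N..<0}"
  proof
    fix x assume "x \<in> G"
    with b[OF this] show "x \<in> {- int N..<0}" by (auto simp: N_def G_def)
  qed
  have eq: "{x \<in> X. - int N \<le> x} = P \<union> ({- int N..<0} - G)"
    by (auto simp: P_def G_def)
  have "card {x \<in> X. - int N \<le> x} = card P + card ({- int N..<0} - G)"
    unfolding eq by (rule card_Un_disjoint) (use fin in \<open>auto simp: P_def\<close>)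
  also have "card ({- int N..<0} - G) = N - card G"
    using card_Diff_subset[OF fin(2) GN] by simp
  also have "card P + (N - card G) = N"
    using card_mono[OF _ GN] cG by simp
  finally have "card {x \<in> X. - int N \<le> x} = N" .
  moreover have "x \<in> X" if "x < - int N" for x
    using that GN by (force simp: G_def)
  moreover have "finite {x \<in> X. - int N \<le> x}" unfolding eq using fin by simp
  ultimately show ?thesis by (intro partition_with_beads[of N X])
qed

section \<open>Principal hooks of the two families\<close>

lemma nonneg_beads: "{x \<in> beads l. 0 \<le> x} = (\<lambda>i. int (part l i) - int i) ` diagonal l"
  by (auto simp: beads_def diagonal_def)

lemma diagonal_conjugate:
  assumes "l \<in> partitions"
  shows "diagonal (conjugate l) = diagonal l"
  using le_part_conjugate_iff[OF assms] by (auto simp: diagonal_def)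

text \<open>The diagonal is closed downwards because parts decrease. This links it to the index
  range 1..d in the definition of doubled distinct partitions.\<close>

lemma diagonal_eq:
  assumes "l \<in> partitions"
  shows "diagonal l = {1..card (diagonal l)}"
proof -
  have down: "i \<in> diagonal l" if "j \<in> diagonal l" "1 \<le> i" "i \<le> j" for i j
    using part_antimono[OF assms that(2,3)] that by (simp add: diagonal_def)
  have "diagonal l \<subseteq> {..part l 1}"
    using part_antimono[OF assms, of 1] by (force simp: diagonal_def)
  then have fin: "finite (diagonal l)" by (rule finite_subset) simp
  have "\<exists>k. diagonal l = {1..k}"
  proof (cases "diagonal l = {}")
    case False
    have "diagonal l = {1..Max (diagonal l)}"
      using down[OF Max_in[OF fin False]] Max_ge[OF fin]
      by (auto simp: diagonal_def simp del: Max_ge_iff)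
    then show ?thesis ..
  qed auto
  then obtain k where "diagonal l = {1..k}" by blast
  then show ?thesis by simp
qed

text \<open>The numbers a_i must be \<open>part l i - i\<close>, which strictly decrease in every
  partition. On the diagonal the conjugate part is at least i, so the relation between row and
  column already makes a_i at least 1.\<close>

lemma doubled_distinct_iff_parts:
  assumes "l \<in> partitions"
  shows "doubled_distinct l \<longleftrightarrow> (\<forall>i\<in>diagonal l. part l i = part (conjugate l) i + 1)"
proof
  assume dd: "doubled_distinct l"
  show "\<forall>i\<in>diagonal l. part l i = part (conjugate l) i + 1"
  proof (cases "l = []")
    case False
    then obtain d a where "card (diagonal l) = d"
      and a: "\<forall>i\<in>{1..d}. int (part l i) - int i = a i \<and>
                         int (part (conjugate l) i) - int i = a i - 1"
      using dd by (auto simp: doubled_distinct_def)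
    then have "diagonal l = {1..d}" using diagonal_eq[OF assms] by metis
    then show ?thesis using a by force
  qed (simp add: diagonal_def part_eq_0)
next
  assume *: "\<forall>i\<in>diagonal l. part l i = part (conjugate l) i + 1"
  let ?d = "card (diagonal l)"
  let ?a = "\<lambda>i. int (part l i) - int i"
  show "doubled_distinct l"
  proof (cases "l = []")
    case False
    then have "0 < part l 1" using part_pos_iff[OF assms, of 1] by (cases l) auto
    then have "1 \<in> diagonal l" by (simp add: diagonal_def)
    then have d: "1 \<le> ?d" using diagonal_eq[OF assms] by (metis atLeastAtMost_iff)
    then have "?d \<in> diagonal l" using diagonal_eq[OF assms] by (metis atLeastAtMost_iff order_refl)
    moreover have "1 \<le> ?a i" if "i \<in> diagonal l" for i
    proof -
      have "i \<in> diagonal (conjugate l)" using that diagonal_conjugate[OF assms] by simp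
      then have "i \<le> part (conjugate l) i" by (simp add: diagonal_def)
      then show ?thesis using * that by simp
    qed
    ultimately have "1 \<le> ?a ?d" by blast
    moreover have "\<forall>i j. 1 \<le> i \<and> i < j \<and> j \<le> ?d \<longrightarrow> ?a j < ?a i"
      using bead_strict_antimono[OF assms] by blast
    moreover have "\<forall>i\<in>{1..?d}. int (part l i) - int i = ?a i \<and>
        int (part (conjugate l) i) - int i = ?a i - 1"
      unfolding diagonal_eq[OF assms, symmetric] using * by simp
    ultimately show ?thesis unfolding doubled_distinct_def using d
      by (intro disjI2 exI[of _ ?d] exI[of _ ?a]) simp
  qed (simp add: doubled_distinct_def)
qed

text \<open>The condition on the diagonal says that the nonnegative beads of the conjugate are those
  of \<open>l\<close> lowered by 1. Combined with the reflection x to -1 - x of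
  \<open>beads_conjugate\<close>, this becomes the reflection x to -x.\<close>

lemma doubled_distinct_iff_mirrored:
  assumes "l \<in> partitions"
  shows "doubled_distinct l \<longleftrightarrow> mirrored 0 (beads l)"
  unfolding doubled_distinct_iff_parts[OF assms]
proof
  assume *: "\<forall>i\<in>diagonal l. part l i = part (conjugate l) i + 1"
  have conj: "{x \<in> beads (conjugate l). 0 \<le> x} = (\<lambda>x. x - 1) ` {x \<in> beads l. 0 \<le> x}"
    unfolding nonneg_beads diagonal_conjugate[OF assms] image_image
    by (rule image_cong) (use * in auto)
  have pos: "1 \<le> x" if "x \<in> beads l" "0 \<le> x" for x
  proof -
    have "x - 1 \<in> (\<lambda>x. x - 1) ` {x \<in> beads l. 0 \<le> x}" using that by auto
    then show ?thesis unfolding conj[symmetric] by auto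
  qed
  have "- x \<in> beads l \<longleftrightarrow> x \<notin> beads l" if "x < 0" for x
  proof -
    have "x \<notin> beads l \<longleftrightarrow> - 1 - x \<in> {x \<in> beads (conjugate l). 0 \<le> x}"
      using that by (simp add: beads_conjugate[OF assms])
    also have "\<dots> \<longleftrightarrow> - x \<in> beads l"
      unfolding conj using that by (auto intro!: image_eqI[of _ _ "- x"])
    finally show ?thesis by simp
  qed
  then show "mirrored 0 (beads l)"
    unfolding mirrored_def
  proof (intro allI)
    fix x
    show "x < 0 \<and> x \<notin> beads l \<longleftrightarrow> 0 \<le> - 0 - x \<and> - 0 - x \<in> beads l"
      if "\<And>x. x < 0 \<Longrightarrow> - x \<in> beads l \<longleftrightarrow> x \<notin> beads l"
      using pos[of 0] that[of x] by (cases x "0 :: int" rule: linorder_cases) auto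
  qed
next
  assume *: "mirrored 0 (beads l)"
  have shift: "z \<in> beads (conjugate l) \<longleftrightarrow> z + 1 \<in> beads l" if "0 \<le> z" for z
  proof -
    have "- 1 - z = - (z + 1)" by simp
    then have "- 1 - z \<in> beads l \<longleftrightarrow> z + 1 \<notin> beads l"
      using mirrored_0D[OF *, of "z + 1"] that by (simp only:)
    then show ?thesis by (auto simp: beads_conjugate[OF assms])
  qed
  show "\<forall>i\<in>diagonal l. part l i = part (conjugate l) i + 1"
  proof
    fix i assume i: "i \<in> diagonal l"
    define x where "x = int (part l i) - int i"
    have x: "x \<in> beads l" "0 \<le> x" using i by (auto simp: x_def beads_def diagonal_def)
    moreover have "0 \<notin> beads l" using * mirrored_0_iff by blast
    ultimately have x1: "1 \<le> x" by (cases "x = 0") auto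
    \<comment> \<open>Lowering by 1 preserves ranks, so x - 1 has rank i among the beads of the
      conjugate and is the bead of its row i.\<close>
    have "{z \<in> beads l. x \<le> z} = (\<lambda>z. z + 1) ` {z \<in> beads (conjugate l). x - 1 \<le> z}"
      using x1 shift by (force intro!: image_eqI[of _ _ "_ - 1"])
    then have "card {z \<in> beads l. x \<le> z} = card {z \<in> beads (conjugate l). x - 1 \<le> z}"
      by (simp add: card_image)
    moreover have "card {z \<in> beads l. x \<le> z} = i"
      unfolding x_def using card_beads_ge[OF assms] i by (simp add: diagonal_def)
    moreover have "x - 1 \<in> beads (conjugate l)" using shift[of "x - 1"] x x1 by simp
    ultimately have "int (part (conjugate l) i) - int i = x - 1"
      using bead_of_rank[OF conjugate_in_partitions[OF assms]] by simp
    then show "part l i = part (conjugate l) i + 1" by (simp add: x_def)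
  qed
qed

lemma principal_hook_lengths_self_conjugate:
  assumes "self_conjugate l"
  shows "principal_hook_lengths l = (\<lambda>x. 2 * x + 1) ` {x \<in> beads l. 0 \<le> x}"
  unfolding principal_hook_lengths_def nonneg_beads image_image
  by (rule image_cong) (use assms in \<open>auto simp: hook_length_def self_conjugate_def\<close>)

lemma principal_hook_lengths_doubled_distinct:
  assumes "l \<in> partitions" "doubled_distinct l"
  shows "principal_hook_lengths l = (\<lambda>x. 2 * x) ` {x \<in> beads l. 0 \<le> x}"
  unfolding principal_hook_lengths_def nonneg_beads image_image
  by (rule image_cong) (use assms doubled_distinct_iff_parts in \<open>auto simp: hook_length_def\<close>)

section \<open>Merging the two bead sets\<close>

text \<open>Together with the symmetry, finiteness ensures that a set comes from a partition.
  Besides the beads of cores, with c = 1 or c = 0, this describes the merged set, with c = 0 and 2 *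
  s in place of s.\<close>

definition bead_set :: "int \<Rightarrow> int \<Rightarrow> int set \<Rightarrow> bool" where
  "bead_set c s X \<longleftrightarrow> mirrored c X \<and> (\<forall>x\<in>X. x - s \<in> X) \<and> finite {x \<in> X. 0 \<le> x}"

definition merge :: "int set \<Rightarrow> int set \<Rightarrow> int set" where
  "merge X Y = (\<lambda>x. 2 * x + 1) ` X \<union> (\<lambda>x. 2 * x) ` Y"

lemma odd_mem_merge: "2 * x + 1 \<in> merge X Y \<longleftrightarrow> x \<in> X"
  unfolding merge_def by auto presburger

lemma even_mem_merge: "2 * x \<in> merge X Y \<longleftrightarrow> x \<in> Y"
  unfolding merge_def by auto presburger

lemma merge_odd_even: "merge {x. 2 * x + 1 \<in> S} {x. 2 * x \<in> S} = S"
proof (intro set_eqI)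
  fix y :: int
  show "y \<in> merge {x. 2 * x + 1 \<in> S} {x. 2 * x \<in> S} \<longleftrightarrow> y \<in> S"
    by (cases "even y") (auto simp: odd_mem_merge even_mem_merge elim!: evenE oddE)
qed

lemma merge_eq_iff: "merge X Y = merge X' Y' \<longleftrightarrow> X = X' \<and> Y = Y'"
  by (metis even_mem_merge odd_mem_merge set_eqI)

lemma nonneg_merge:
  "{y \<in> merge X Y. 0 \<le> y} = (\<lambda>x. 2 * x + 1) ` {x \<in> X. 0 \<le> x} \<union> (\<lambda>x. 2 * x) ` {x \<in> Y. 0 \<le> x}"
  by (auto simp: merge_def)

text \<open>Negation preserves parity: it sends 2 * x + 1 to 2 * (-1 - x) + 1 and 2 * x to 2 * (-x),
  which are the reflections for c = 1 and c = 0.\<close>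

lemma mirrored_merge_iff: "mirrored 0 (merge X Y) \<longleftrightarrow> mirrored 1 X \<and> mirrored 0 Y"
proof -
  have all: "(\<forall>y::int. P y) \<longleftrightarrow> (\<forall>x. P (2 * x + 1)) \<and> (\<forall>x. P (2 * x))" for P
    by (metis evenE oddE)
  have odd: "- (2 * x + 1) \<in> merge X Y \<longleftrightarrow> - 1 - x \<in> X" for x
    using odd_mem_merge[of "- 1 - x" X Y] by (simp add: algebra_simps)
  have even: "- (2 * x) \<in> merge X Y \<longleftrightarrow> - x \<in> Y" for x
    using even_mem_merge[of "- x" X Y] by simp
  have nz: "2 * x + 1 = 0 \<longleftrightarrow> False" "2 * x = 0 \<longleftrightarrow> x = 0" for x :: int by presburger+
  have zero: "0 \<in> merge X Y \<longleftrightarrow> 0 \<in> Y" using even_mem_merge[of 0 X Y] by simp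
  have "mirrored 0 (merge X Y) \<longleftrightarrow> 0 \<notin> merge X Y \<and>
      (\<forall>x. 2 * x + 1 \<noteq> 0 \<longrightarrow> (- (2 * x + 1) \<in> merge X Y \<longleftrightarrow> 2 * x + 1 \<notin> merge X Y)) \<and>
      (\<forall>x. 2 * x \<noteq> 0 \<longrightarrow> (- (2 * x) \<in> merge X Y \<longleftrightarrow> 2 * x \<notin> merge X Y))"
    unfolding mirrored_0_iff by (subst all) (rule refl)
  then show ?thesis
    unfolding mirrored_0_iff mirrored_1_iff odd even odd_mem_merge even_mem_merge nz zero
    by blast
qed

lemma bead_set_merge_iff: "bead_set 0 (2 * s) (merge X Y) \<longleftrightarrow> bead_set 1 s X \<and> bead_set 0 s Y"
proof -
  have odd: "2 * x + 1 - 2 * s \<in> merge X Y \<longleftrightarrow> x - s \<in> X" for x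
    using odd_mem_merge[of "x - s" X Y] by (simp add: algebra_simps)
  have even: "2 * x - 2 * s \<in> merge X Y \<longleftrightarrow> x - s \<in> Y" for x
    using even_mem_merge[of "x - s" X Y] by (simp add: algebra_simps)
  have "(\<forall>y\<in>merge X Y. y - 2 * s \<in> merge X Y) \<longleftrightarrow> (\<forall>x\<in>X. x - s \<in> X) \<and> (\<forall>x\<in>Y. x - s \<in> Y)"
    using odd even by (auto simp: merge_def ball_Un)
  moreover have "finite {y \<in> merge X Y. 0 \<le> y} \<longleftrightarrow> finite {x \<in> X. 0 \<le> x} \<and> finite {x \<in> Y. 0 \<le> x}"
    unfolding nonneg_merge by (simp add: finite_image_iff inj_on_def)
  ultimately show ?thesis by (auto simp: bead_set_def mirrored_merge_iff)
qed

section \<open>Coordinates of a bead set\<close>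

lemma int_down_closed_threshold:
  fixes P :: "int \<Rightarrow> bool"
  assumes step: "\<And>k. P k \<Longrightarrow> P (k - 1)" and ex: "P a" and bound: "\<And>k. P k \<Longrightarrow> k < b"
  shows "\<exists>m. \<forall>k. P k \<longleftrightarrow> k \<le> m"
proof -
  have down: "P j" if "P k" "j \<le> k" for j k
    using that(2,1) by (induction rule: int_le_induct) (auto intro: step)
  define K where "K = {k \<in> {a..<b}. P k}"
  have "finite K" unfolding K_def by (rule finite_subset[of _ "{a..<b}"]) auto
  moreover have "a \<in> K" using ex bound by (auto simp: K_def)
  ultimately have K: "finite K" "a \<in> K" .
  have "P k \<longleftrightarrow> k \<le> Max K" for k
  proof
    assume "P k"
    show "k \<le> Max K"
    proof (cases "a \<le> k")
      case True
      then have "k \<in> K" using \<open>P k\<close> bound by (simp add: K_def)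
      then show ?thesis by (rule Max_ge[OF K(1)])
    next
      case False
      then show ?thesis using Max_ge[OF K] by linarith
    qed
  next
    assume "k \<le> Max K"
    moreover have "P (Max K)" using Max_in[OF K(1)] K(2) by (auto simp: K_def)
    ultimately show "P k" by (rule down[rotated])
  qed
  then show ?thesis by blast
qed

definition coord :: "int \<Rightarrow> int set \<Rightarrow> int \<Rightarrow> int" where
  "coord s S i = (THE m. \<forall>k. i - s + 2 * s * k \<in> S \<longleftrightarrow> k \<le> m)"

lemma coord_eqI:
  assumes "\<And>k. i - s + 2 * s * k \<in> S \<longleftrightarrow> k \<le> m"
  shows "coord s S i = m"
  unfolding coord_def
  by (rule the_equality) (use assms in \<open>auto intro: antisym\<close>)

text \<open>Closure under subtracting 2 * s makes the class of i - s a downward ray, finiteness of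
  the nonnegative elements bounds it above, and the symmetry makes it nonempty. Hence the threshold
  \<open>coord\<close> exists.\<close>

lemma mem_iff_le_coord:
  assumes "bead_set 0 (2 * s) S" "0 < s"
  shows "i - s + 2 * s * k \<in> S \<longleftrightarrow> k \<le> coord s S i"
proof -
  have mirr: "0 \<notin> S" "\<And>x. x \<noteq> 0 \<Longrightarrow> - x \<in> S \<longleftrightarrow> x \<notin> S"
    and step: "\<And>x. x \<in> S \<Longrightarrow> x - 2 * s \<in> S" and fin: "finite {x \<in> S. 0 \<le> x}"
    using assms(1) by (auto simp: bead_set_def mirrored_0_iff)
  define b where "b = Max (insert 0 {x \<in> S. 0 \<le> x})"
  have b0: "0 \<le> b" using fin by (simp add: b_def)
  have b: "x \<le> b" if "x \<in> S" for x
  proof (cases "0 \<le> x")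
    case True
    then show ?thesis unfolding b_def using that fin by (intro Max_ge) auto
  qed (use b0 in simp)
  have large: "k \<le> s * k" if "0 \<le> k" for k using that assms(2) by (simp add: mult_le_cancel_right1)
  have "\<exists>m. \<forall>k. i - s + 2 * s * k \<in> S \<longleftrightarrow> k \<le> m"
  proof (rule int_down_closed_threshold)
    show "i - s + 2 * s * (k - 1) \<in> S" if "i - s + 2 * s * k \<in> S" for k
      using step[OF that] by (simp add: algebra_simps)
    show "k < b + s + \<bar>i\<bar> + 1" if "i - s + 2 * s * k \<in> S" for k
      using b[OF that] large[of k] b0 assms(2) by (cases "0 \<le> k") auto
    \<comment> \<open>\<open>b\<close> bounds S, and k = -(b + |i| + 1) is so negative that the
      mirror image \<open>y\<close> of the element exceeds \<open>b\<close>; so \<open>y\<close> is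
      not in S, and its negative is.\<close>
    define y where "y = - (i - s + 2 * s * - (b + \<bar>i\<bar> + 1))"
    have "y = s - i + 2 * (s * (b + \<bar>i\<bar> + 1))" by (simp add: y_def algebra_simps)
    then have "b < y" using large[of "b + \<bar>i\<bar> + 1"] b0 assms(2) by linarith
    then have "- y \<in> S" using mirr(2)[of y] b[of y] b0 by auto
    then show "i - s + 2 * s * - (b + \<bar>i\<bar> + 1) \<in> S" by (simp only: y_def minus_minus)
  qed
  then obtain m where "\<And>k. i - s + 2 * s * k \<in> S \<longleftrightarrow> k \<le> m" by blast
  then show ?thesis using coord_eqI[of i s S m] by simp
qed

lemma mult_eq_small:
  fixes d s k :: int
  assumes "d = 2 * s * k" "\<bar>d\<bar> < 2 * s"
  shows "d = 0"
  using assms dvd_imp_le_int[of d "2 * s"] by fastforce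

text \<open>The class of -i - s is the mirror image of that of i - s: negating the element for k
  gives the element \<open>y\<close> for 1 - k, which must exceed the threshold. The bounds on i
  keep \<open>y\<close> away from 0, where the symmetry fails.\<close>

lemma mem_iff_le_neg_coord:
  assumes "bead_set 0 (2 * s) S" "0 < i" "i < s"
  shows "- i - s + 2 * s * k \<in> S \<longleftrightarrow> k \<le> - coord s S i"
proof -
  define y where "y = i - s + 2 * s * (1 - k)"
  have "y \<noteq> 0"
  proof
    assume "y = 0"
    then have "s - i = 2 * s * (1 - k)" by (simp add: y_def)
    from mult_eq_small[OF this] assms show False by simp
  qed
  then have "- y \<in> S \<longleftrightarrow> y \<notin> S" using assms(1) by (auto simp: bead_set_def mirrored_0_iff)
  also have "\<dots> \<longleftrightarrow> k \<le> - coord s S i"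
    using mem_iff_le_coord[OF assms(1), of i "1 - k"] assms by (auto simp: y_def)
  finally show ?thesis by (simp add: y_def algebra_simps)
qed

text \<open>The classes of 0 and s modulo 2 * s are their own mirror images and carry no freedom.
  Neither 0 nor s is in S, the latter because s - 2 * s = -s would be in S too; larger multiples
  descend to these two in steps of 2 * s.\<close>

lemma mult_mem_iff_neg:
  assumes "bead_set 0 (2 * s) S" "0 < s"
  shows "s * k \<in> S \<longleftrightarrow> k < 0"
proof -
  have mirr: "0 \<notin> S" "\<And>x. x \<noteq> 0 \<Longrightarrow> - x \<in> S \<longleftrightarrow> x \<notin> S"
    and step: "\<And>x. x \<in> S \<Longrightarrow> x - 2 * s \<in> S"
    using assms(1) by (auto simp: bead_set_def mirrored_0_iff)
  have nonneg: "s * int j \<notin> S" for j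
  proof (induction j rule: less_induct)
    case (less j)
    consider "j = 0" | "j = 1" | "2 \<le> j" by linarith
    then show ?case
    proof cases
      case 2
      then show ?thesis using step[of s] mirr(2)[of s] assms(2) by auto
    next
      case 3
      have "s * int (j - 2) = s * int j - 2 * s" using 3 by (simp add: of_nat_diff algebra_simps)
      then show ?thesis using less[of "j - 2"] step[of "s * int j"] 3 by auto
    qed (use mirr in simp)
  qed
  show ?thesis
  proof (cases "k < 0")
    case True
    then show ?thesis
      using nonneg[of "nat (- k)"] mirr(2)[of "s * - k"] assms(2) by simp
  next
    case False
    then show ?thesis using nonneg[of "nat k"] by simp
  qed
qed

lemma residue_cases:
  fixes s y :: int
  assumes "0 < s"
  obtains (mult) k where "y = s * k"
    | (pos) i k where "0 < i" "i < s" "y = i - s + 2 * s * k"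
    | (neg) i k where "0 < i" "i < s" "y = - i - s + 2 * s * k"
proof -
  define r where "r = (y + s) mod (2 * s)"
  define k where "k = (y + s) div (2 * s)"
  have r: "0 \<le> r" "r < 2 * s" using assms by (simp_all add: r_def)
  have y: "y = r - s + 2 * s * k"
    using div_mult_mod_eq[of "y + s" "2 * s"] by (simp add: r_def k_def algebra_simps)
  consider "r = 0" | "0 < r" "r < s" | "r = s" | "s < r" using r by linarith
  then show thesis
  proof cases
    case 1
    then show thesis using y by (intro mult[of "2 * k - 1"]) (simp add: algebra_simps)
  next
    case 2
    then show thesis using y by (intro pos[of r k])
  next
    case 3
    then show thesis using y by (intro mult[of "2 * k"]) (simp add: algebra_simps)
  next
    case 4
    \<comment> \<open>With r = 2 * s - i, rewriting r - s as -i - s costs one full period, hence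
      \<open>k + 1\<close>.\<close>
    then show thesis using y r by (intro neg[of "2 * s - r" "k + 1"]) (auto simp: algebra_simps)
  qed
qed

lemma bead_set_eqI:
  assumes S: "bead_set 0 (2 * s) S" and S': "bead_set 0 (2 * s) S'" and "0 < s"
    and eq: "\<And>i. 0 < i \<Longrightarrow> i < s \<Longrightarrow> coord s S i = coord s S' i"
  shows "S = S'"
proof (rule set_eqI)
  fix y
  show "y \<in> S \<longleftrightarrow> y \<in> S'"
    using \<open>0 < s\<close>
  proof (cases rule: residue_cases[where y = y])
    case (mult k)
    then show ?thesis using mult_mem_iff_neg S S' \<open>0 < s\<close> by blast
  next
    case (pos i k)
    then show ?thesis using mem_iff_le_coord[OF S] mem_iff_le_coord[OF S'] eq by simp
  next
    case (neg i k)
    then show ?thesis using mem_iff_le_neg_coord[OF S] mem_iff_le_neg_coord[OF S'] eq by simp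
  qed
qed

lemma bead_set_with_coords:
  fixes s :: int and n :: "int \<Rightarrow> int"
  assumes "0 < s"
  shows "\<exists>S. bead_set 0 (2 * s) S \<and> (\<forall>i. 0 < i \<and> i < s \<longrightarrow> coord s S i = n i)"
proof -
  \<comment> \<open>\<open>h r\<close> is the threshold for the class of r - s. For 0 < r < s it is
    prescribed; the mirrored class gets the complementary threshold, with an extra -1 because its
    representative s - i is one period above -i - s. The values at r = 0 and r = s leave exactly the
    negative multiples of s.\<close>
  define h where "h = (\<lambda>r. if r = 0 then 0 else if r < s then n r
    else if r = s then - 1 else - n (2 * s - r) - 1)"
  define S where "S = {y. (y + s) div (2 * s) \<le> h ((y + s) mod (2 * s))}"
  have mem: "r - s + 2 * s * k \<in> S \<longleftrightarrow> k \<le> h r" if "0 \<le> r" "r < 2 * s" for r k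
    using that assms by (simp add: S_def)
  have rep: "\<exists>r k. y = r - s + 2 * s * k \<and> 0 \<le> r \<and> r < 2 * s" for y
    using div_mult_mod_eq[of "y + s" "2 * s"] assms
    by (intro exI[of _ "(y + s) mod (2 * s)"] exI[of _ "(y + s) div (2 * s)"])
      (simp add: algebra_simps)
  have zero: "0 \<notin> S" using mem[of s 0] assms by (simp add: h_def)
  have "- y \<in> S \<longleftrightarrow> y \<notin> S" if "y \<noteq> 0" for y
  proof -
    obtain r k where y: "y = r - s + 2 * s * k" "0 \<le> r" "r < 2 * s" using rep by blast
    show ?thesis
    \<comment> \<open>Negation exchanges the classes r and 2 * s - r. The case r = 0 is separate
      since 2 * s is not a reduced residue modulo itself, and r = s because that class contains
      0.\<close>
    proof (cases "r = 0")
      case True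
      have "- y = 0 - s + 2 * s * (1 - k)" using y True by (simp add: algebra_simps)
      then have "- y \<in> S \<longleftrightarrow> 1 - k \<le> h 0" using mem[of 0 "1 - k"] assms by simp
      moreover have "y \<in> S \<longleftrightarrow> k \<le> h 0" using mem[of 0 k] assms y True by simp
      ultimately show ?thesis by (auto simp: h_def)
    next
      case False
      have "- y = (2 * s - r) - s + 2 * s * (- k)" using y by (simp add: algebra_simps)
      then have 1: "- y \<in> S \<longleftrightarrow> - k \<le> h (2 * s - r)"
        using mem[of "2 * s - r" "- k"] y False by simp
      have 2: "y \<in> S \<longleftrightarrow> k \<le> h r" using mem[of r k] y by simp
      show ?thesis
      proof (cases "r = s")
        case True
        then have "k \<noteq> 0" using y that by auto
        then show ?thesis using 1 2 True assms by (auto simp: h_def)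
      next
        case neq: False
        then have "h (2 * s - r) = - h r - 1" using False y by (auto simp: h_def)
        then show ?thesis using 1 2 by auto
      qed
    qed
  qed
  then have "mirrored 0 S" using zero by (simp add: mirrored_0_iff)
  moreover have "y - 2 * s \<in> S" if "y \<in> S" for y
  proof -
    obtain r k where y: "y = r - s + 2 * s * k" "0 \<le> r" "r < 2 * s" using rep by blast
    then have eq: "y - 2 * s = r - s + 2 * s * (k - 1)" by (simp add: algebra_simps)
    have "k \<le> h r" using mem[OF y(2,3)] that y(1) by simp
    then show ?thesis unfolding eq mem[OF y(2,3)] by simp
  qed
  moreover have "finite {y \<in> S. 0 \<le> y}"
  proof -
    define b where "b = Max (h ` {0..<2 * s})"
    have "y \<le> s + 2 * s * b" if "y \<in> S" for y
    proof -
      obtain r k where y: "y = r - s + 2 * s * k" "0 \<le> r" "r < 2 * s" using rep by blast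
      have "k \<le> h r" using mem[of r k] y that by simp
      also have "h r \<le> b" unfolding b_def using y by (intro Max_ge) auto
      finally have "2 * s * k \<le> 2 * s * b" using assms by simp
      then show ?thesis using y by linarith
    qed
    then have "{y \<in> S. 0 \<le> y} \<subseteq> {0..s + 2 * s * b}" by auto
    then show ?thesis by (rule finite_subset) simp
  qed
  moreover have "coord s S i = n i" if "0 < i" "i < s" for i
    by (rule coord_eqI) (use mem[of i] that in \<open>simp add: h_def\<close>)
  ultimately show ?thesis by (intro exI[of _ S]) (auto simp: bead_set_def)
qed

section \<open>Sums and maxima over paired residue classes\<close>

definition residue_part :: "int \<Rightarrow> int set \<Rightarrow> int \<Rightarrow> int set" where
  "residue_part s S i =
     {y \<in> S. 0 \<le> y \<and> ([y = i - s] (mod 2 * s) \<or> [y = - i - s] (mod 2 * s))}"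

text \<open>As i lies strictly between 0 and s, an element of either class is nonnegative exactly
  for k at least 1. The thresholds n_i and -n_i have opposite signs, so at most one of the two
  progressions is nonempty.\<close>

lemma residue_part_eq:
  assumes "bead_set 0 (2 * s) S" "0 < i" "i < s"
  shows "residue_part s S i = (\<lambda>k. i - s + 2 * s * k) ` {1..coord s S i} \<union>
    (\<lambda>k. - i - s + 2 * s * k) ` {1..- coord s S i}"
proof -
  have cong: "[y = a] (mod 2 * s) \<longleftrightarrow> (\<exists>k. y = a + 2 * s * k)" for y a
    by (subst cong_sym_eq) (rule cong_iff_lin)
  have ge: "0 \<le> a - s + 2 * s * k \<longleftrightarrow> 1 \<le> k" if "- s < a" "a < s" for a k
  proof -
    define z where "z = 2 * s * k"
    have "2 * s \<le> z" if "1 \<le> k" using that assms by (simp add: z_def)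
    moreover have "z \<le> 0" if "k \<le> 0" using that assms by (simp add: z_def mult_le_0_iff)
    ultimately show ?thesis unfolding z_def[symmetric] using that by (cases "1 \<le> k") auto
  qed
  show ?thesis
    unfolding residue_part_def cong
    using mem_iff_le_coord[OF assms(1)] mem_iff_le_neg_coord[OF assms] ge[of i] ge[of "- i"] assms
    by auto
qed

lemma sum_arith_progression:
  fixes a s m :: int
  assumes "0 \<le> m"
  shows "(\<Sum>k = 1..m. a + 2 * s * k) = a * m + s * m * (m + 1)"
  using assms
proof (induction m rule: int_ge_induct)
  case (step m)
  have "{1..m + 1} = insert (m + 1) {1..m}" using step by auto
  then show ?case using step by (simp add: algebra_simps)
qed simp

text \<open>The progression that remains has |n_i| terms. The multiple of s linear in n_i cancels,
  and both signs of n_i lead to the same expression.\<close>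

lemma sum_residue_part:
  assumes "bead_set 0 (2 * s) S" "0 < i" "i < s"
  shows "\<Sum>(residue_part s S i) = s * (coord s S i)\<^sup>2 + i * coord s S i"
proof -
  let ?n = "coord s S i"
  have inj: "inj_on (\<lambda>k. a + 2 * s * k) A" for a A using assms by (auto simp: inj_on_def)
  show ?thesis
  proof (cases "0 \<le> ?n")
    case True
    then have "\<Sum>(residue_part s S i) = (\<Sum>k = 1..?n. i - s + 2 * s * k)"
      unfolding residue_part_eq[OF assms] by (simp add: sum.reindex[OF inj])
    then show ?thesis
      unfolding sum_arith_progression[OF True] by (simp add: algebra_simps power2_eq_square)
  next
    case False
    then have n: "0 \<le> - ?n" by simp
    have "\<Sum>(residue_part s S i) = (\<Sum>k = 1..- ?n. - i - s + 2 * s * k)"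
      unfolding residue_part_eq[OF assms] using False by (simp add: sum.reindex[OF inj])
    then show ?thesis
      unfolding sum_arith_progression[OF n] by (simp add: algebra_simps power2_eq_square)
  qed
qed

lemma Max_residue_part:
  assumes "bead_set 0 (2 * s) S" "0 < i" "i < s"
  shows "s + Max (residue_part s S i \<union> {i - s})
    = sign_of (coord s S i) * (2 * s * coord s S i + i)"
proof -
  let ?n = "coord s S i"
  have s: "0 < s" using assms by simp
  show ?thesis
  proof (cases "0 \<le> ?n")
    case True
    then have "residue_part s S i \<union> {i - s} = (\<lambda>k. i - s + 2 * s * k) ` {0..?n}"
    proof -
      \<comment> \<open>The default element i - s is the term k = 0 of the progression, which also
        covers n_i = 0.\<close>
      have "{0..?n} = insert 0 {1..?n}" using True by auto
      then show ?thesis unfolding residue_part_eq[OF assms] using True by simp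
    qed
    moreover have "Max \<dots> = i - s + 2 * s * ?n"
      using True s by (intro Max_eqI) auto
    ultimately show ?thesis using True by (simp add: sign_of_def)
  next
    case False
    \<comment> \<open>A negative coordinate puts at least one full period into the largest term, so
      the default i - s does not exceed it.\<close>
    have "s * 1 \<le> s * - ?n" using False s by (intro mult_left_mono) auto
    then have "2 * s \<le> 2 * s * - ?n" by simp
    then have low: "i - s \<le> - i - s + 2 * s * - ?n" using assms by linarith
    have eq: "residue_part s S i = (\<lambda>k. - i - s + 2 * s * k) ` {1..- ?n}"
      unfolding residue_part_eq[OF assms] using False by simp
    have "Max (residue_part s S i \<union> {i - s}) = - i - s + 2 * s * - ?n"
    proof (rule Max_eqI)
      fix y assume "y \<in> residue_part s S i \<union> {i - s}"
      then consider k where "y = - i - s + 2 * s * k" "k \<le> - ?n" | "y = i - s"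
        unfolding eq by fastforce
      then show "y \<le> - i - s + 2 * s * - ?n"
      proof cases
        case (1 k)
        then have "2 * s * k \<le> 2 * s * - ?n" using s by (intro mult_left_mono) auto
        then show ?thesis using 1 by linarith
      qed (use low in linarith)
    next
      show "- i - s + 2 * s * - ?n \<in> residue_part s S i \<union> {i - s}"
        unfolding eq using False by (intro UnI1 imageI) simp
    qed (simp add: eq)
    then show ?thesis using False by (simp add: sign_of_def)
  qed
qed

text \<open>The numbers i and -i differ from j and -j by nonzero amounts smaller than 2 * s in
  absolute value, so none of the classes coincide.\<close>

lemma residue_part_disjoint:
  assumes "0 < i" "i < s" "0 < j" "j < s" "i \<noteq> j"
  shows "residue_part s S i \<inter> residue_part s S j = {}"
proof -
  have no: "\<not> [a - s = b - s] (mod 2 * s)" if "a - b \<noteq> 0" "\<bar>a - b\<bar> < 2 * s" for a b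
  proof
    assume "[a - s = b - s] (mod 2 * s)"
    then have "2 * s dvd a - b" by (simp add: cong_iff_dvd_diff)
    then obtain k where "a - b = 2 * s * k" by (rule dvdE)
    from mult_eq_small[OF this that(2)] that(1) show False by simp
  qed
  have "\<not> [i - s = j - s] (mod 2 * s)" "\<not> [i - s = - j - s] (mod 2 * s)"
    "\<not> [- i - s = j - s] (mod 2 * s)" "\<not> [- i - s = - j - s] (mod 2 * s)"
    using assms by (intro no; linarith)+
  then show ?thesis unfolding residue_part_def by (auto dest: cong_trans[OF cong_sym])
qed

text \<open>By \<open>residue_cases\<close> only multiples of s escape the paired classes, and those
  in S are negative.\<close>

lemma nonneg_bead_set_eq:
  assumes "bead_set 0 (2 * s) S" "0 < s"
  shows "{y \<in> S. 0 \<le> y} = (\<Union>i\<in>{0<..<s}. residue_part s S i)"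
proof -
  have "\<exists>i\<in>{0<..<s}. [y = i - s] (mod 2 * s) \<or> [y = - i - s] (mod 2 * s)"
    if "y \<in> S" "0 \<le> y" for y
    using assms(2)
  proof (cases rule: residue_cases[where y = y])
    case (mult k)
    then have "k < 0" using mult_mem_iff_neg[OF assms] that by simp
    then have "s * k < 0" using assms(2) by (simp add: mult_less_0_iff)
    then show ?thesis using mult that by simp
  next
    case (pos i k)
    then show ?thesis by (intro bexI[of _ i]) (auto simp: cong_iff_dvd_diff)
  next
    case (neg i k)
    then show ?thesis by (intro bexI[of _ i]) (auto simp: cong_iff_dvd_diff)
  qed
  then show ?thesis by (auto simp: residue_part_def)
qed

lemma sum_nonneg_bead_set:
  assumes "bead_set 0 (2 * s) S" "0 < s"
  shows "\<Sum>{y \<in> S. 0 \<le> y} = (\<Sum>i\<in>{0<..<s}. s * (coord s S i)\<^sup>2 + i * coord s S i)"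
proof -
  have "finite (residue_part s S i)" for i
    by (rule finite_subset[of _ "{y \<in> S. 0 \<le> y}"])
      (use assms in \<open>auto simp: residue_part_def bead_set_def\<close>)
  then have "\<Sum>(\<Union>i\<in>{0<..<s}. residue_part s S i) = (\<Sum>i\<in>{0<..<s}. \<Sum>(residue_part s S i))"
    by (intro sum.UNION_disjoint) (auto simp: residue_part_disjoint)
  also have "\<dots> = (\<Sum>i\<in>{0<..<s}. s * (coord s S i)\<^sup>2 + i * coord s S i)"
    by (rule sum.cong) (auto simp: sum_residue_part[OF assms(1)])
  finally show ?thesis unfolding nonneg_bead_set_eq[OF assms] .
qed

section \<open>From pairs of cores to integer vectors\<close>

lemma SC_iff_bead_set:
  assumes "1 \<le> s"
  shows "l \<in> SC s \<longleftrightarrow> l \<in> partitions \<and> bead_set 1 (int s) (beads l)"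
  using is_core_iff_beads[OF _ assms] self_conjugate_iff_mirrored finite_nonneg_beads
  by (auto simp: SC_def bead_set_def)

lemma DD_iff_bead_set:
  assumes "1 \<le> s"
  shows "l \<in> DD s \<longleftrightarrow> l \<in> partitions \<and> bead_set 0 (int s) (beads l)"
  using is_core_iff_beads[OF _ assms] doubled_distinct_iff_mirrored finite_nonneg_beads
  by (auto simp: DD_def bead_set_def)

lemma bij_betw_merge_beads:
  assumes "1 \<le> s"
  shows "bij_betw (\<lambda>(l, m). merge (beads l) (beads m)) (SC s \<times> DD s)
    {S. bead_set 0 (2 * int s) S}"
proof (rule bij_betw_imageI)
  show "inj_on (\<lambda>(l, m). merge (beads l) (beads m)) (SC s \<times> DD s)"
    by (auto simp: inj_on_def merge_eq_iff SC_def DD_def intro: beads_inj)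
  show "(\<lambda>(l, m). merge (beads l) (beads m)) ` (SC s \<times> DD s) = {S. bead_set 0 (2 * int s) S}"
  proof (intro equalityI subsetI)
    fix S assume "S \<in> {S. bead_set 0 (2 * int s) S}"
    moreover obtain X Y where S: "S = merge X Y" using merge_odd_even[symmetric] by blast
    ultimately have X: "bead_set 1 (int s) X" and Y: "bead_set 0 (int s) Y"
      by (simp_all add: bead_set_merge_iff)
    obtain l where l: "l \<in> partitions" "beads l = X"
      using X partition_with_mirrored_beads[of 1 X] by (auto simp: bead_set_def)
    obtain m where m: "m \<in> partitions" "beads m = Y"
      using Y partition_with_mirrored_beads[of 0 Y] by (auto simp: bead_set_def)
    have "(l, m) \<in> SC s \<times> DD s"
      using X Y l m by (simp add: SC_iff_bead_set[OF assms] DD_iff_bead_set[OF assms])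
    then show "S \<in> (\<lambda>(l, m). merge (beads l) (beads m)) ` (SC s \<times> DD s)"
      by (rule rev_image_eqI) (simp add: S l m)
  qed (auto simp: bead_set_merge_iff SC_iff_bead_set[OF assms] DD_iff_bead_set[OF assms])
qed

lemma Delta_eq_nonneg_merge:
  assumes "l \<in> SC s" "m \<in> DD s"
  shows "Delta (l, m) = {y \<in> merge (beads l) (beads m). 0 \<le> y}"
  using assms by (simp add: Delta_def nonneg_merge principal_hook_lengths_self_conjugate
      principal_hook_lengths_doubled_distinct SC_def DD_def)

text \<open>Each weight is the sum of the principal hook lengths by \<open>weight_mirrored\<close>;
  those of the two partitions differ in parity, so nothing is lost in the union.\<close>

lemma weight_SC_DD:
  assumes "l \<in> SC s" "m \<in> DD s"
  shows "int (weight l + weight m) = \<Sum>{y \<in> merge (beads l) (beads m). 0 \<le> y}"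
proof -
  have l: "l \<in> partitions" "mirrored 1 (beads l)" and m: "m \<in> partitions" "mirrored 0 (beads m)"
    using assms self_conjugate_iff_mirrored doubled_distinct_iff_mirrored
    by (auto simp: SC_def DD_def)
  have "\<Sum>{y \<in> merge (beads l) (beads m). 0 \<le> y} =
      \<Sum>((\<lambda>x. 2 * x + 1) ` {x \<in> beads l. 0 \<le> x}) + \<Sum>((\<lambda>x. 2 * x) ` {x \<in> beads m. 0 \<le> x})"
    unfolding nonneg_merge
  proof (rule sum.union_disjoint)
    show "(\<lambda>x. 2 * x + 1) ` {x \<in> beads l. 0 \<le> x} \<inter> (\<lambda>x. 2 * x) ` {x \<in> beads m. 0 \<le> x} = {}"
      by auto presburger
  qed (use finite_nonneg_beads l m in auto)
  also have "\<Sum>((\<lambda>x. 2 * x + 1) ` {x \<in> beads l. 0 \<le> x}) = int (weight l)"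
    unfolding weight_mirrored[OF l] by (subst sum.reindex) (auto simp: inj_on_def)
  also have "\<Sum>((\<lambda>x. 2 * x) ` {x \<in> beads m. 0 \<le> x}) = int (weight m)"
    unfolding weight_mirrored[OF m] by (subst sum.reindex) (auto simp: inj_on_def)
  finally show ?thesis by simp
qed

lemma bij_betw_coords:
  "bij_betw (\<lambda>S. \<lambda>i\<in>{1..t}. coord (int (t + 1)) S (int i))
     {S. bead_set 0 (2 * int (t + 1)) S} (int_vectors t)"
proof (rule bij_betw_imageI)
  let ?s = "int (t + 1)"
  let ?c = "\<lambda>S. \<lambda>i\<in>{1..t}. coord ?s S (int i)"
  show "inj_on ?c {S. bead_set 0 (2 * ?s) S}"
  proof (rule inj_onI)
    fix S S' assume S: "S \<in> {S. bead_set 0 (2 * ?s) S}" and S': "S' \<in> {S. bead_set 0 (2 * ?s) S}"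
      and eq: "?c S = ?c S'"
    show "S = S'"
    proof (rule bead_set_eqI)
      fix i assume "0 < i" "i < ?s"
      then have i: "nat i \<in> {1..t}" "int (nat i) = i" by auto
      have "?c S (nat i) = ?c S' (nat i)" by (rule fun_cong[OF eq])
      then show "coord ?s S i = coord ?s S' i" by (simp only: restrict_apply i if_True)
    qed (use S S' in auto)
  qed
  show "?c ` {S. bead_set 0 (2 * ?s) S} = int_vectors t"
  proof (intro equalityI subsetI)
    fix n assume n: "n \<in> int_vectors t"
    obtain S where S: "bead_set 0 (2 * ?s) S"
      and coord: "\<And>i. 0 < i \<Longrightarrow> i < ?s \<Longrightarrow> coord ?s S i = n (nat i)"
      using bead_set_with_coords[of ?s "\<lambda>i. n (nat i)"] by auto
    \<comment> \<open>Outside 1..t both functions equal \<open>undefined\<close>, so agreement of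
      the coordinates suffices.\<close>
    have "n = ?c S"
    proof
      fix i
      show "n i = ?c S i"
        using n coord[of "int i"] by (auto simp: int_vectors_def PiE_def extensional_def)
    qed
    then show "n \<in> ?c ` {S. bead_set 0 (2 * ?s) S}" using S by blast
  qed (auto simp: int_vectors_def)
qed

theorem theorem3p2:
  fixes t :: nat
  assumes "t \<ge> 2"
  shows "\<exists>\<phi> :: nat list \<times> nat list \<Rightarrow> (nat \<Rightarrow> int).
    bij_betw \<phi> (SC (t + 1) \<times> DD (t + 1)) (int_vectors t) \<and>
    (\<forall>lam \<in> SC (t + 1). \<forall>mu \<in> DD (t + 1). \<forall>n. n = \<phi> (lam, mu) \<longrightarrow>
       real (weight lam + weight mu)
         = real (t + 1) * (euclidean_norm t n)\<^sup>2 + real_of_int (scalar_product t (e_vec t) n) \<and>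
       real (t + 1) * (euclidean_norm t n)\<^sup>2 + real_of_int (scalar_product t (e_vec t) n)
         = real_of_int (\<Sum>i = 1..t. int (t + 1) * (n i)\<^sup>2 + int i * n i) \<and>
       (\<forall>i \<in> {1..t}. int t + 1 + Delta_max t (lam, mu) i
         = sign_of (n i) * (int (2 * t + 2) * n i + int i)))"
proof -
  \<comment> \<open>With s = t + 1 the modulus 2 * t + 2 is 2 * s, and the default value i - t - 1
    is i - s.\<close>
  define s where "s = int (t + 1)"
  define M where "M = (\<lambda>(l, m). merge (beads l) (beads m))"
  define c where "c = (\<lambda>S. \<lambda>i\<in>{1..t}. coord s S (int i))"
  have bij: "bij_betw (c \<circ> M) (SC (t + 1) \<times> DD (t + 1)) (int_vectors t)"
    unfolding c_def M_def s_def
    by (rule bij_betw_trans[OF bij_betw_merge_beads bij_betw_coords]) simp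
  have norm: "real (t + 1) * (euclidean_norm t n)\<^sup>2 + real_of_int (scalar_product t (e_vec t) n)
      = real_of_int (\<Sum>i = 1..t. int (t + 1) * (n i)\<^sup>2 + int i * n i)" for n
  proof -
    have "(euclidean_norm t n)\<^sup>2 = (\<Sum>i = 1..t. (real_of_int (n i))\<^sup>2)"
      by (simp add: euclidean_norm_def L2_set_def sum_nonneg)
    moreover have "scalar_product t (e_vec t) n = (\<Sum>i = 1..t. int i * n i)"
      by (simp add: scalar_product_def e_vec_def)
    ultimately show ?thesis by (simp add: sum.distrib sum_distrib_left)
  qed
  have main: "int (weight l + weight m) = (\<Sum>i = 1..t. int (t + 1) * (n i)\<^sup>2 + int i * n i) \<and>
      (\<forall>i\<in>{1..t}. int t + 1 + Delta_max t (l, m) i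
         = sign_of (n i) * (int (2 * t + 2) * n i + int i))"
    if l: "l \<in> SC (t + 1)" and m: "m \<in> DD (t + 1)" and n: "n = (c \<circ> M) (l, m)" for l m n
  proof -
    define S where "S = merge (beads l) (beads m)"
    have "S \<in> {S. bead_set 0 (2 * s) S}"
      using bij_betw_apply[OF bij_betw_merge_beads[of "t + 1"], of "(l, m)"] l m
      by (simp add: S_def s_def)
    then have S: "bead_set 0 (2 * s) S" by simp
    have s: "0 < s" by (simp add: s_def)
    have coord: "coord s S (int i) = n i" if "i \<in> {1..t}" for i
      using that by (simp add: n c_def M_def S_def)
    have coord': "n (nat i) = coord s S i" if "0 < i" "i < s" for i
    proof -
      have "nat i \<in> {1..t}" using that by (auto simp: s_def)
      then show ?thesis using coord[of "nat i"] that by (simp del: atLeastAtMost_iff)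
    qed
    have "int (weight l + weight m) = (\<Sum>i\<in>{0<..<s}. s * (coord s S i)\<^sup>2 + i * coord s S i)"
      unfolding weight_SC_DD[OF l m] S_def[symmetric] by (rule sum_nonneg_bead_set[OF S s])
    also have "\<dots> = (\<Sum>i = 1..t. s * (n i)\<^sup>2 + int i * n i)"
      by (rule sum.reindex_bij_witness[of _ int nat]) (auto simp: s_def coord'[unfolded s_def])
    finally have weight: "int (weight l + weight m) = (\<Sum>i = 1..t. s * (n i)\<^sup>2 + int i * n i)" .
    have "int t + 1 + Delta_max t (l, m) i = sign_of (n i) * (int (2 * t + 2) * n i + int i)"
      if i: "i \<in> {1..t}" for i
    proof -
      have "{h \<in> Delta (l, m). [h = int i - int t - 1] (mod (2 * int t + 2)) \<or>
          [h = - int i - int t - 1] (mod (2 * int t + 2))} = residue_part s S (int i)"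
        unfolding residue_part_def Delta_eq_nonneg_merge[OF l m] S_def[symmetric]
        by (simp add: s_def algebra_simps)
      then have "Delta_max t (l, m) i = Max (residue_part s S (int i) \<union> {int i - s})"
        unfolding Delta_max_def by (simp add: s_def algebra_simps)
      then show ?thesis
        using Max_residue_part[OF S, of "int i"] coord[OF i] i by (simp add: s_def algebra_simps)
    qed
    then show ?thesis using weight by (simp add: s_def)
  qed
  show ?thesis
  proof (intro exI[of _ "c \<circ> M"] conjI ballI allI impI bij norm)
    fix l m n assume lm: "l \<in> SC (t + 1)" "m \<in> DD (t + 1)" "n = (c \<circ> M) (l, m)"
    show "real (weight l + weight m)
        = real (t + 1) * (euclidean_norm t n)\<^sup>2 + real_of_int (scalar_product t (e_vec t) n)"
      unfolding norm using main[OF lm] by (metis of_int_of_nat_eq)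
    show "int t + 1 + Delta_max t (l, m) i = sign_of (n i) * (int (2 * t + 2) * n i + int i)"
      if "i \<in> {1..t}" for i
      using main[OF lm] that by blast
  qed
qed

end
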